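(* Let $k\ge3$. There exist $k-1$ Short $\mathbb{C}^k$'s $\Omega_1,\dots,\Omega_{k-1}\subset\mathbb{C}^k$ such that $\Omega_i\cap\Omega_j=\emptyset$ for all $i\ne j$.
   Context: A Short $\mathbb{C}^k$ is a domain $\Omega\subset\mathbb{C}^k$ such that: (1) $\Omega=\bigcup_{j\ge1}\Omega_j$ with $\Omega_j\subset\Omega_{j+1}$ and each $\Omega_j$ biholomorphic to the unit ball of $\mathbb{C}^k$; (2) the infinitesimal Kobayashi pseudometric of $\Omega$ vanishes identically; (3) $\Omega$ carries a non-constant plurisubharmonic function that is bounded above (in particular $\Omega$ is not biholomorphic to $\mathbb{C}^k$). *)

theory Defs
  imports "HOL-Analysis.Analysis"
begin

text \<open>We model \<open>\<complex>^k\<close> as the type \<open>complex ^ 'n\<close> with \<open>k = CARD('n)\<close>,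
  with its Euclidean (Hermitian) norm.  The scalar action of \<open>\<complex>\<close> is \<open>*s\<close>.\<close>

definition complex_linear :: "(complex ^ 'n \<Rightarrow> complex ^ 'm) \<Rightarrow> bool" where
  "complex_linear L \<longleftrightarrow>
     (\<forall>x y. L (x + y) = L x + L y) \<and> (\<forall>c x. L (c *s x) = c *s L x)"

definition holo_map :: "(complex ^ 'n \<Rightarrow> complex ^ 'm) \<Rightarrow> (complex ^ 'n) set \<Rightarrow> bool" where
  "holo_map F U \<longleftrightarrow>
     (\<forall>z\<in>U. \<exists>L. complex_linear L \<and> (F has_derivative L) (at z))"

definition holo_curve :: "(complex \<Rightarrow> complex ^ 'n) \<Rightarrow> complex set \<Rightarrow> bool" where
  "holo_curve f U \<longleftrightarrow> (\<forall>t\<in>U. \<exists>w. (f has_derivative (\<lambda>h. h *s w)) (at t))"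

definition biholo_to_unit_ball :: "(complex ^ 'n) set \<Rightarrow> bool" where
  "biholo_to_unit_ball A \<longleftrightarrow> open A \<and>
     (\<exists>(F :: complex ^ 'n \<Rightarrow> complex ^ 'n) (G :: complex ^ 'n \<Rightarrow> complex ^ 'n). holo_map F (ball 0 1) \<and> holo_map G A \<and> F ` ball 0 1 = A \<and>
        (\<forall>z\<in>ball 0 1. G (F z) = z) \<and> (\<forall>w\<in>A. F (G w) = w))"

definition kobayashi :: "(complex ^ 'n) set \<Rightarrow> complex ^ 'n \<Rightarrow> complex ^ 'n \<Rightarrow> real" where
  "kobayashi \<Omega> z v = Inf {\<alpha>::real. \<alpha> > 0 \<and>
     (\<exists>f w. holo_curve f (ball 0 1) \<and> f ` ball 0 1 \<subseteq> \<Omega> \<and> f 0 = z \<and>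
            (f has_derivative (\<lambda>h. h *s w)) (at 0) \<and> \<alpha> *\<^sub>R w = v)}"

definition circle_mean :: "(complex ^ 'n \<Rightarrow> ereal) \<Rightarrow> complex ^ 'n \<Rightarrow> complex ^ 'n \<Rightarrow> real \<Rightarrow> ereal" where
  "circle_mean u a b r =
     (let g = (\<lambda>\<theta>. u (a + (complex_of_real r * cis \<theta>) *s b)) in
      (enn2ereal (\<integral>\<^sup>+ \<theta>. e2ennreal (max 0 (g \<theta>)) * indicator {0..2*pi} \<theta> \<partial>lborel)
       - enn2ereal (\<integral>\<^sup>+ \<theta>. e2ennreal (max 0 (- g \<theta>)) * indicator {0..2*pi} \<theta> \<partial>lborel))
      / ereal (2 * pi))"

definition psh :: "(complex ^ 'n) set \<Rightarrow> (complex ^ 'n \<Rightarrow> ereal) \<Rightarrow> bool" where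
  "psh \<Omega> u \<longleftrightarrow>
     (\<forall>z\<in>\<Omega>. u z \<noteq> \<infinity>) \<and>
     (\<forall>z\<in>\<Omega>. \<forall>c. u z < c \<longrightarrow> (\<exists>e>0. \<forall>w\<in>\<Omega> \<inter> ball z e. u w < c)) \<and>
     (\<forall>a b r. r > 0 \<and> {a + \<zeta> *s b | \<zeta>. cmod \<zeta> \<le> r} \<subseteq> \<Omega> \<longrightarrow> u a \<le> circle_mean u a b r)"

definition short_Ck :: "(complex ^ 'n) set \<Rightarrow> bool" where
  "short_Ck \<Omega> \<longleftrightarrow> open \<Omega> \<and> connected \<Omega> \<and>
     (\<exists>D :: nat \<Rightarrow> (complex ^ 'n) set. (\<forall>j. D j \<subseteq> D (Suc j)) \<and> (\<Union>j. D j) = \<Omega> \<and>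
        (\<forall>j. biholo_to_unit_ball (D j))) \<and>
     (\<forall>z\<in>\<Omega>. \<forall>v. kobayashi \<Omega> z v = 0) \<and>
     (\<exists>u. psh \<Omega> u \<and> (\<exists>M::real. \<forall>z\<in>\<Omega>. u z \<le> ereal M) \<and> (\<exists>z\<in>\<Omega>. \<exists>w\<in>\<Omega>. u z \<noteq> u w))"

end

theory Submission
  imports Defs "HOL-Complex_Analysis.Conformal_Mappings" "HOL-Real_Asymp.Real_Asymp"
begin

unbundle no fps_syntax

text \<open>
  Single out two coordinates \<open>z\<close>, \<open>w\<close> and consider the automorphisms
  \<open>F\<^sub>n (z, w, x) = (z - sin z + a\<^sub>n w, a\<^sub>n (a\<^sub>n w - sin z), a\<^sub>n x)\<close> with \<open>a\<^sub>n = s\<^bsup>3^(n+1) + 1\<^esup>\<close>.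
  They fix the origin and commute with the translation by \<open>2\<pi>\<close> in \<open>z\<close>, so every point
  \<open>(2\<pi>j, 0, 0)\<close> has a basin of attraction under the compositions \<open>F\<^sub>n \<circ> \<dots> \<circ> F\<^sub>0\<close>, and
  different basins are disjoint.

  On the ball of radius \<open>1/4\<close> all \<open>F\<^sub>n\<close> contract by a factor \<open>1/2\<close>.  Hence a basin is an increasing
  union of preimages of that ball, and since the derivatives of the compositions tend to \<open>0\<close>,
  preimages of linear discs in the ball are arbitrarily large discs in every direction: the Kobayashi
  metric vanishes.

  Let \<open>h\<^sub>n\<close> be the \<open>z\<close>-coordinate of the \<open>n\<close>-th composition.  As \<open>z - sin z\<close> is of order \<open>z\<^sup>3\<close>, the
  functions \<open>3\<^sup>-\<^sup>n log max |h\<^sub>n| s\<^bsup>3^n\<^esup>\<close> decrease on the basin.  Their limit is plurisubharmonic, takes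
  values in \<open>[log s, 0]\<close>, and is non-constant: it equals \<open>log s\<close> at the center, but is at least
  \<open>log (1/32)\<close> at distance \<open>1/8\<close> from it.
\<close>

section \<open>Holomorphic maps\<close>

lemma norm_vector_smult:
  fixes x :: "complex ^ 'n"
  shows "norm (c *s x) = norm c * norm x"
  by (simp add: norm_vec_def norm_mult L2_set_right_distrib)

lemma bounded_linear_smult_left:
  fixes w :: "complex ^ 'n"
  shows "bounded_linear (\<lambda>c. c *s w)"
proof (rule bounded_linear_intro[where K = "norm w"])
  show "(c + d) *s w = c *s w + d *s w" for c d :: complex
    by (simp add: vec_eq_iff algebra_simps)
  show "(a *\<^sub>R c) *s w = a *\<^sub>R (c *s w)" for a and c :: complex
    by (simp add: vec_eq_iff)
  show "norm (c *s w) \<le> norm c * norm w" for c :: complex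
    by (simp add: norm_vector_smult)
qed

lemma scaleR_eq_smult:
  fixes x :: "complex ^ 'n"
  shows "r *\<^sub>R x = complex_of_real r *s x"
  unfolding vec_eq_iff vector_scaleR_component vector_smult_component
  by (simp add: scaleR_conv_of_real)

lemma has_derivative_vec_componentwise:
  fixes f :: "'a::real_normed_vector \<Rightarrow> complex ^ 'n"
  assumes "\<And>i. ((\<lambda>x. f x $ i) has_derivative (\<lambda>h. f' h $ i)) F"
  shows "(f has_derivative f') F"
proof -
  have eq: "x = (\<Sum>i\<in>UNIV. axis i (x $ i))" for x :: "complex ^ 'n"
    by (simp add: vec_eq_iff axis_def if_distrib [of "\<lambda>g. g _"] cong: if_cong)
  have bl: "bounded_linear (axis i :: complex \<Rightarrow> complex ^ 'n)" for i
    by (intro linear_conv_bounded_linear[THEN iffD1] linearI) (auto simp: vec_eq_iff axis_def)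
  have "((\<lambda>x. \<Sum>i\<in>UNIV. axis i (f x $ i)) has_derivative (\<lambda>h. \<Sum>i\<in>UNIV. axis i (f' h $ i))) F"
    by (intro has_derivative_sum bounded_linear.has_derivative[OF bl] assms)
  then show ?thesis
    by (simp flip: eq)
qed

lemma norm_le_sum_components:
  fixes x :: "complex ^ 'n"
  shows "norm x \<le> (\<Sum>i\<in>UNIV. norm (x $ i))"
  unfolding norm_vec_def by (rule L2_set_le_sum) simp

lemma holo_map_compose:
  fixes f :: "complex ^ 'n \<Rightarrow> complex ^ 'm" and g :: "complex ^ 'm \<Rightarrow> complex ^ 'k"
  assumes "holo_map f U" "holo_map g V" "f ` U \<subseteq> V"
  shows "holo_map (\<lambda>x. g (f x)) U"
  unfolding holo_map_def
proof
  fix z assume z: "z \<in> U"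
  obtain L where L: "complex_linear L" "(f has_derivative L) (at z)"
    using assms z unfolding holo_map_def by blast
  obtain M where M: "complex_linear M" "(g has_derivative M) (at (f z))"
    using assms z unfolding holo_map_def by blast
  have "complex_linear (\<lambda>x. M (L x))"
    using L M by (simp add: complex_linear_def)
  with has_derivative_compose[OF L(2) M(2)]
  show "\<exists>K. complex_linear K \<and> ((\<lambda>x. g (f x)) has_derivative K) (at z)"
    by blast
qed

lemma holo_map_subset: "holo_map f U \<Longrightarrow> V \<subseteq> U \<Longrightarrow> holo_map f V"
  unfolding holo_map_def by blast

lemma holo_map_continuous_on: "holo_map f U \<Longrightarrow> continuous_on U f"
  unfolding holo_map_def
  by (meson continuous_at_imp_continuous_on has_derivative_continuous)

lemma holo_map_translate:
  fixes c :: "complex ^ 'n"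
  shows "holo_map (\<lambda>x. x + c) U"
  unfolding holo_map_def complex_linear_def
  by (auto intro!: exI[of _ "\<lambda>x. x"] derivative_eq_intros)

lemma holo_map_scaleR:
  "holo_map (\<lambda>x :: complex ^ 'n. r *\<^sub>R x) U"
  unfolding holo_map_def complex_linear_def
  by (auto intro!: exI[of _ "\<lambda>x. r *\<^sub>R x"] derivative_eq_intros simp: scaleR_add_right vec_eq_iff)

text \<open>Complex linearity of \<open>L\<close> turns the derivative along \<open>h *s b\<close>
  into multiplication by the number \<open>L b $ p\<close>. This reduces the sub-mean value property
  on complex lines to one variable.\<close>

lemma holo_map_nth_along_line:
  fixes f :: "complex ^ 'n \<Rightarrow> complex ^ 'n"
  assumes "holo_map f UNIV"
  shows "(\<lambda>t. f (a + t *s b) $ p) holomorphic_on S"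
proof -
  have "(\<lambda>t. f (a + t *s b) $ p) field_differentiable (at t)" for t
  proof -
    obtain L where L: "complex_linear L" "(f has_derivative L) (at (a + t *s b))"
      using assms unfolding holo_map_def by blast
    have "((\<lambda>t. a + t *s b) has_derivative (\<lambda>h. h *s b)) (at t)"
      by (auto intro!: derivative_eq_intros bounded_linear_imp_has_derivative bounded_linear_smult_left)
    from has_derivative_compose[OF this L(2)]
    have "((\<lambda>t. f (a + t *s b) $ p) has_derivative (\<lambda>h. L (h *s b) $ p)) (at t)"
      by (rule bounded_linear.has_derivative[OF bounded_linear_vec_nth])
    moreover have "(\<lambda>h. L (h *s b) $ p) = (*) (L b $ p)"
      using L by (auto simp: complex_linear_def)
    ultimately show ?thesis
      by (auto simp: field_differentiable_def has_field_derivative_def)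
  qed
  then show ?thesis
    by (simp add: field_differentiable_at_within holomorphic_on_def)
qed

section \<open>Basins of contracting sequences of automorphisms\<close>

text \<open>\<open>\<Phi> n\<close> stands for a composition, \<open>\<Psi> n\<close> for its
  inverse and \<open>F n\<close> for the next factor. \<open>\<Phi> 0\<close> may differ from the
  identity, so that the basin can have any center. Contraction is required of the derivatives
  because the Kobayashi metric needs it there; contraction of values follows.\<close>

locale contracting_basin =
  fixes \<Phi> \<Psi> F :: "nat \<Rightarrow> complex ^ 'n \<Rightarrow> complex ^ 'n" and r :: real
  assumes holo_fwd: "holo_map (\<Phi> n) UNIV"
    and holo_bwd: "holo_map (\<Psi> n) UNIV"
    and bwd_fwd: "\<Psi> n (\<Phi> n x) = x"
    and fwd_bwd: "\<Phi> n (\<Psi> n x) = x"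
    and fwd_Suc: "\<Phi> (Suc n) x = F n (\<Phi> n x)"
    and F_zero: "F n 0 = 0"
    and r_pos: "r > 0"
    and F_contracts: "norm y < r \<Longrightarrow>
      \<exists>L. complex_linear L \<and> (F n has_derivative L) (at y) \<and> (\<forall>v. norm (L v) \<le> norm v / 2)"
begin

definition layer :: "nat \<Rightarrow> (complex ^ 'n) set" where
  "layer n = {x. norm (\<Phi> n x) < r}"

definition basin :: "(complex ^ 'n) set" where
  "basin = (\<Union>n. layer n)"

text \<open>Mean value inequality on the convex ball, together with the fixed point 0.\<close>

lemma norm_F_le:
  assumes "norm y < r"
  shows "norm (F n y) \<le> norm y / 2"
proof -
  have "\<forall>y. \<exists>L. norm y < r \<longrightarrow> (F n has_derivative L) (at y) \<and> (\<forall>v. norm (L v) \<le> norm v / 2)"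
    using F_contracts by blast
  then obtain L where L: "\<And>y. norm y < r \<Longrightarrow> (F n has_derivative L y) (at y)"
    "\<And>y v. norm y < r \<Longrightarrow> norm (L y v) \<le> norm v / 2"
    by metis
  have "norm (F n y - F n 0) \<le> 1/2 * norm (y - 0)"
  proof (rule differentiable_bound[where S = "ball 0 r" and f' = L])
    show "(F n has_derivative L x) (at x within ball 0 r)" if "x \<in> ball 0 r" for x
      using L(1)[of x] that by (auto intro: has_derivative_at_withinI)
    show "onorm (L x) \<le> 1/2" if "x \<in> ball 0 r" for x
      by (rule onorm_le) (use L(2)[of x] that in auto)
  qed (use assms r_pos in auto)
  then show ?thesis by (simp add: F_zero)
qed

text \<open>The bound itself keeps the orbit in the ball of radius \<open>r\<close>, so the
  contraction applies again at each step.\<close>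

lemma norm_fwd_add_le:
  assumes "x \<in> layer n"
  shows "norm (\<Phi> (n + m) x) \<le> norm (\<Phi> n x) / 2 ^ m"
proof (induction m)
  case (Suc m)
  have "norm (\<Phi> n x) / 2 ^ m \<le> norm (\<Phi> n x) / 1"
    by (rule divide_left_mono) auto
  with Suc have "norm (\<Phi> (n + m) x) < r"
    using assms by (auto simp: layer_def)
  from norm_F_le[OF this, of "n + m"] divide_right_mono[OF Suc, of 2] show ?case
    by (simp add: fwd_Suc mult.commute)
qed auto

lemma layer_mono: assumes "n \<le> m" shows "layer n \<subseteq> layer m"
proof
  fix x assume x: "x \<in> layer n"
  have "norm (\<Phi> n x) / 2 ^ (m - n) \<le> norm (\<Phi> n x) / 1"
    by (rule divide_left_mono) auto
  with norm_fwd_add_le[OF x, of "m - n"] x assms show "x \<in> layer m"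
    by (auto simp: layer_def)
qed

lemma fwd_tendsto_0:
  assumes "x \<in> basin"
  shows "(\<lambda>n. \<Phi> n x) \<longlonglongrightarrow> 0"
proof -
  obtain N where N: "x \<in> layer N" using assms by (auto simp: basin_def)
  have "(\<lambda>m. norm (\<Phi> N x) / 2 ^ m) \<longlonglongrightarrow> 0"
    by real_asymp
  then have "(\<lambda>m. \<Phi> (m + N) x) \<longlonglongrightarrow> 0"
    by (rule Lim_null_comparison[rotated]) (use norm_fwd_add_le[OF N] in \<open>simp add: add.commute\<close>)
  then show ?thesis by (rule LIMSEQ_offset)
qed

lemma layer_eq_image: "layer n = \<Psi> n ` ball 0 r"
  by (auto simp: layer_def fwd_bwd image_iff intro!: bexI[of _ "\<Phi> n _"] simp: bwd_fwd)

lemma open_layer: "open (layer n)"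
proof -
  have "continuous_on UNIV (\<Phi> n)"
    using holo_fwd by (rule holo_map_continuous_on)
  then have "open (\<Phi> n -` ball 0 r)"
    by (intro open_vimage) auto
  moreover have "layer n = \<Phi> n -` ball 0 r"
    by (auto simp: layer_def)
  ultimately show ?thesis by simp
qed

lemma open_basin: "open basin"
  unfolding basin_def using open_layer by blast

text \<open>\<open>\<Psi> 0 0\<close> is the center of the basin. Being common to all layers, it
  makes their union connected.\<close>

lemma fwd_bwd_zero: "\<Phi> n (\<Psi> 0 0) = 0"
  by (induction n) (auto simp: fwd_bwd fwd_Suc F_zero)

lemma connected_basin: "connected basin"
  unfolding basin_def
proof (rule connected_Union)
  show "connected S" if "S \<in> range layer" for S
  proof -
    obtain n where S: "S = \<Psi> n ` ball 0 r" using \<open>S \<in> range layer\<close> layer_eq_image by auto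
    show ?thesis unfolding S
      by (intro connected_continuous_image holo_map_continuous_on holo_map_subset[OF holo_bwd]) auto
  qed
  have "\<Psi> 0 0 \<in> layer n" for n
    using fwd_bwd_zero[of n] r_pos by (simp add: layer_def)
  then show "\<Inter> (range layer) \<noteq> {}" by blast
qed

lemma biholo_layer: "biholo_to_unit_ball (layer n)"
  unfolding biholo_to_unit_ball_def
proof (intro conjI exI ballI)
  show "holo_map (\<lambda>z. \<Psi> n (r *\<^sub>R z)) (ball 0 1)"
    by (rule holo_map_compose[OF holo_map_scaleR holo_bwd]) auto
  show "holo_map (\<lambda>w. inverse r *\<^sub>R \<Phi> n w) (layer n)"
    by (rule holo_map_compose[OF holo_map_subset[OF holo_fwd] holo_map_scaleR]) auto
  show "(\<lambda>z. \<Psi> n (r *\<^sub>R z)) ` ball 0 1 = layer n"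
  proof -
    have "(\<lambda>z. r *\<^sub>R z) ` ball 0 1 = (ball 0 r :: (complex ^ 'n) set)"
      using ball_scale[of r 0 1] r_pos by auto
    then show ?thesis
      by (simp add: layer_eq_image flip: image_image)
  qed
qed (use r_pos in \<open>auto simp: open_layer bwd_fwd fwd_bwd\<close>)

text \<open>Chain rule: a point of \<open>layer n\<close> stays in the later layers, so each further
  factor halves the image of \<open>v\<close>.\<close>

lemma derivative_fwd_decay:
  assumes x: "x \<in> layer n"
    and L: "complex_linear L" "(\<Phi> n has_derivative L) (at x)"
  shows "\<exists>M. complex_linear M \<and> (\<Phi> (n + m) has_derivative M) (at x) \<and> norm (M v) \<le> norm (L v) / 2 ^ m"
proof (induction m)
  case 0
  then show ?case using L by auto
next
  case (Suc m)
  then obtain M where M: "complex_linear M" "(\<Phi> (n + m) has_derivative M) (at x)"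
    "norm (M v) \<le> norm (L v) / 2 ^ m" by blast
  have "x \<in> layer (n + m)" using layer_mono[of n "n + m"] x by auto
  then obtain K where K: "complex_linear K" "(F (n + m) has_derivative K) (at (\<Phi> (n + m) x))"
    "\<And>v. norm (K v) \<le> norm v / 2"
    using F_contracts[of "\<Phi> (n + m) x" "n + m"] by (auto simp: layer_def)
  have "((\<lambda>x. F (n + m) (\<Phi> (n + m) x)) has_derivative (\<lambda>v. K (M v))) (at x)"
    by (rule has_derivative_compose[OF M(2) K(2)])
  then have "(\<Phi> (n + Suc m) has_derivative (\<lambda>v. K (M v))) (at x)"
    by (simp add: fwd_Suc[abs_def])
  moreover have "complex_linear (\<lambda>v. K (M v))"
    using K M by (simp add: complex_linear_def)
  moreover have "norm (K (M v)) \<le> norm (L v) / 2 ^ Suc m"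
    using K(3)[of "M v"] divide_right_mono[OF M(3), of 2] by (simp add: mult.commute)
  ultimately show ?case by blast
qed

text \<open>For every \<open>R > 0\<close> and large \<open>n\<close>, the linear disc at
  \<open>\<Phi> n x\<close> with derivative \<open>R *\<^sub>R M v\<close> fits into the ball. Its
  preimage under \<open>\<Phi> n\<close> is a disc in the basin through \<open>x\<close> with
  derivative \<open>R *\<^sub>R v\<close>, so \<open>1 / R\<close> is admissible.\<close>

lemma kobayashi_basin:
  assumes x: "x \<in> basin"
  shows "kobayashi basin x v = 0"
proof -
  define S where "S = {\<alpha>::real. \<alpha> > 0 \<and>
     (\<exists>f w. holo_curve f (ball 0 1) \<and> f ` ball 0 1 \<subseteq> basin \<and> f 0 = x \<and>
            (f has_derivative (\<lambda>h. h *s w)) (at 0) \<and> \<alpha> *\<^sub>R w = v)}"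
  obtain N where N: "x \<in> layer N" using x by (auto simp: basin_def)
  obtain L where L: "complex_linear L" "(\<Phi> N has_derivative L) (at x)"
    using holo_fwd[of N] unfolding holo_map_def by blast
  have inS: "1 / R \<in> S" if R: "R > 0" for R
  proof -
    \<comment> \<open>The first term bounds the center of the linear disc, the second its radius;
      both tend to 0 for fixed \<open>R\<close>.\<close>
    have "(\<lambda>m. norm (\<Phi> N x) / 2 ^ m + R * (norm (L v) / 2 ^ m)) \<longlonglongrightarrow> 0"
      by real_asymp
    from order_tendstoD(2)[OF this r_pos]
    obtain m where m: "norm (\<Phi> N x) / 2 ^ m + R * (norm (L v) / 2 ^ m) < r"
      using eventually_happens by force
    define n where "n = N + m"
    obtain M where M: "complex_linear M" "(\<Phi> n has_derivative M) (at x)"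
      "norm (M v) \<le> norm (L v) / 2 ^ m"
      using derivative_fwd_decay[OF N L] unfolding n_def by blast
    have bound: "norm (\<Phi> n x) + R * norm (M v) < r"
      using m norm_fwd_add_le[OF N, of m] mult_left_mono[OF M(3), of R] R
      unfolding n_def by linarith
    define \<gamma> where "\<gamma> = (\<lambda>t. \<Phi> n x + t *s (R *\<^sub>R M v))"
    define f where "f = (\<lambda>t. \<Psi> n (\<gamma> t))"
    have \<gamma>': "(\<gamma> has_derivative (\<lambda>h. h *s (R *\<^sub>R M v))) (at t)" for t
      unfolding \<gamma>_def
      by (auto intro!: derivative_eq_intros bounded_linear_imp_has_derivative bounded_linear_smult_left)
    have f': "(f has_derivative (\<lambda>h. h *s K (R *\<^sub>R M v))) (at t)"
      if "complex_linear K" "(\<Psi> n has_derivative K) (at (\<gamma> t))" for K t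
      using has_derivative_compose[OF \<gamma>' that(2)] that(1)
      unfolding f_def by (simp add: complex_linear_def)
    have curve: "holo_curve f (ball 0 1)"
      unfolding holo_curve_def using holo_bwd[of n] f' unfolding holo_map_def by blast
    have img: "f ` ball 0 1 \<subseteq> basin"
    proof clarsimp
      fix t :: complex assume t: "cmod t < 1"
      have "norm (\<gamma> t) \<le> norm (\<Phi> n x) + cmod t * (R * norm (M v))"
        unfolding \<gamma>_def using R
        by (intro norm_triangle_le) (simp add: norm_vector_smult)
      also have "\<dots> \<le> norm (\<Phi> n x) + 1 * (R * norm (M v))"
        using t R by (intro add_left_mono mult_right_mono) auto
      also have "\<dots> < r" using bound by simp
      finally have "f t \<in> layer n"
        by (simp add: layer_def f_def fwd_bwd)
      then show "f t \<in> basin"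
        by (auto simp: basin_def)
    qed
    have f0: "f 0 = x" by (simp add: f_def \<gamma>_def bwd_fwd)
    obtain K where K: "complex_linear K" "(\<Psi> n has_derivative K) (at (\<gamma> 0))"
      using holo_bwd[of n] unfolding holo_map_def by blast
    \<comment> \<open>Differentiating the identity \<open>\<Psi> n (\<Phi> n x) = x\<close> shows
      that \<open>K\<close> is a left inverse of \<open>M\<close>.\<close>
    have "((\<lambda>x. \<Psi> n (\<Phi> n x)) has_derivative (\<lambda>v. K (M v))) (at x)"
      by (rule has_derivative_compose[OF M(2)]) (use K in \<open>simp add: \<gamma>_def\<close>)
    then have "(\<lambda>v. K (M v)) = (\<lambda>v. v)"
      by (intro has_derivative_unique[OF _ has_derivative_ident]) (simp add: bwd_fwd)
    then have "K (M v) = v" by metis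
    then have "K (R *\<^sub>R M v) = R *\<^sub>R v"
      using K by (simp add: scaleR_eq_smult complex_linear_def)
    then have "(1 / R) *\<^sub>R K (R *\<^sub>R M v) = v" using R by simp
    then show ?thesis
      unfolding S_def using R curve img f0 f'[OF K] by auto
  qed
  have "Inf S = 0"
  proof (rule antisym)
    have bdd: "bdd_below S" by (auto simp: S_def intro: bdd_belowI[of _ 0])
    show "Inf S \<le> 0"
    proof (rule field_le_epsilon)
      fix e :: real assume e: "e > 0"
      then have "e \<in> S" using inS[of "1 / e"] by simp
      then show "Inf S \<le> 0 + e" using bdd by (simp add: cInf_lower)
    qed
    show "0 \<le> Inf S"
    proof (rule cInf_greatest)
      show "S \<noteq> {}" using inS[of 1] by auto
    qed (auto simp: S_def)
  qed
  then show ?thesis by (simp add: kobayashi_def S_def)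
qed

lemma short_Ck_basin:
  assumes "psh basin u" "\<And>z. z \<in> basin \<Longrightarrow> u z \<le> ereal M"
    "z \<in> basin" "w \<in> basin" "u z \<noteq> u w"
  shows "short_Ck basin"
  unfolding short_Ck_def
proof (intro conjI)
  show "\<exists>D. (\<forall>j. D j \<subseteq> D (Suc j)) \<and> \<Union> (range D) = basin \<and> (\<forall>j. biholo_to_unit_ball (D j))"
    using layer_mono biholo_layer by (intro exI[of _ layer]) (auto simp: basin_def intro: lessI less_imp_le)
qed (use assms open_basin connected_basin kobayashi_basin in blast)+

end

section \<open>The sub-mean value property\<close>

lemma integral_periodic_shift:
  fixes \<phi> :: "real \<Rightarrow> real"
  assumes cont: "continuous_on UNIV \<phi>" and per: "\<And>t. \<phi> (t + p) = \<phi> t"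
    and "0 \<le> \<theta>" "\<theta> \<le> p"
  shows "integral {\<theta>..\<theta> + p} \<phi> = integral {0..p} \<phi>"
proof -
  have int: "\<phi> integrable_on {a..b}" for a b
    by (intro integrable_continuous_real continuous_on_subset[OF cont]) auto
  have "integral {\<theta>..\<theta> + p} \<phi> = integral {\<theta>..p} \<phi> + integral {p..\<theta> + p} \<phi>"
    using assms by (intro Henstock_Kurzweil_Integration.integral_combine[symmetric] int) auto
  \<comment> \<open>Periodicity moves the part beyond \<open>p\<close> back to the start of the
    period.\<close>
  also have "integral {p..\<theta> + p} \<phi> = integral {0..\<theta>} \<phi>"
    using integral_shift_Icc_real[of 0 \<theta> \<phi> p] per by (simp add: o_def add.commute)
  also have "integral {\<theta>..p} \<phi> + integral {0..\<theta>} \<phi> = integral {0..p} \<phi>"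
    using assms Henstock_Kurzweil_Integration.integral_combine[of 0 \<theta> p \<phi>, OF _ _ int] by auto
  finally show ?thesis .
qed

lemma sum_integral_consecutive:
  fixes \<phi> :: "real \<Rightarrow> real"
  assumes cont: "continuous_on UNIV \<phi>" and "d \<ge> 0"
  shows "(\<Sum>k<N. integral {\<theta> + real k * d..\<theta> + real (Suc k) * d} \<phi>) = integral {\<theta>..\<theta> + real N * d} \<phi>"
proof (induction N)
  case (Suc N)
  have "\<phi> integrable_on {a..b}" for a b
    by (intro integrable_continuous_real continuous_on_subset[OF cont]) auto
  then have "integral {\<theta>..\<theta> + real N * d} \<phi> + integral {\<theta> + real N * d..\<theta> + real (Suc N) * d} \<phi>
      = integral {\<theta>..\<theta> + real (Suc N) * d} \<phi>"
    using assms by (intro Henstock_Kurzweil_Integration.integral_combine) (auto simp: algebra_simps)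
  with Suc show ?case by simp
qed auto

text \<open>The point is that one \<open>N\<close> serves all starting angles \<theta>: the maximum
  principle will need the estimate at every point of a circle. It follows from uniform
  continuity.\<close>

lemma periodic_riemann_sum_le:
  fixes \<phi> :: "real \<Rightarrow> real"
  assumes cont: "continuous_on UNIV \<phi>" and per: "\<And>t. \<phi> (t + 2 * pi) = \<phi> t" and "e > 0"
  obtains N where "N > 0"
    "\<And>\<theta>. 0 \<le> \<theta> \<Longrightarrow> \<theta> \<le> 2 * pi \<Longrightarrow>
      (\<Sum>k<N. \<phi> (\<theta> + real k * (2 * pi / real N))) / real N \<le> integral {0..2*pi} \<phi> / (2 * pi) + e"
proof -
  \<comment> \<open>The interval contains every period starting at some \<theta> between 0 and
    \<open>2 * pi\<close>.\<close>
  have "uniformly_continuous_on {0..4*pi} \<phi>"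
    by (intro compact_uniformly_continuous continuous_on_subset[OF cont]) auto
  then obtain \<delta> where \<delta>: "\<delta> > 0"
    "\<And>s t. s \<in> {0..4*pi} \<Longrightarrow> t \<in> {0..4*pi} \<Longrightarrow> dist t s < \<delta> \<Longrightarrow> dist (\<phi> t) (\<phi> s) < e"
    unfolding uniformly_continuous_on_def using \<open>e > 0\<close> by metis
  obtain N where N: "2 * pi / \<delta> < real N" using reals_Archimedean2 by blast
  have "0 < 2 * pi / \<delta>" using \<delta> by simp
  with N have N0: "N > 0" by (metis of_nat_0_less_iff order.strict_trans)
  define d where "d = 2 * pi / real N"
  have d: "0 < d" "d < \<delta>" "real N * d = 2 * pi"
    using N N0 \<delta> by (auto simp: d_def field_simps)
  show ?thesis
  proof
    show "N > 0" by fact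
    fix \<theta> :: real assume \<theta>: "0 \<le> \<theta>" "\<theta> \<le> 2 * pi"
    have int: "\<phi> integrable_on {a..b}" for a b
      by (intro integrable_continuous_real continuous_on_subset[OF cont]) auto
    have piece: "d * (\<phi> (\<theta> + real k * d) - e) \<le> integral {\<theta> + real k * d..\<theta> + real (Suc k) * d} \<phi>"
      if "k < N" for k
    proof -
      have "real (Suc k) * d \<le> real N * d"
        using that d by (intro mult_right_mono) auto
      then have kd: "real k * d + d \<le> 2 * pi" "0 \<le> real k * d" using d by (auto simp: algebra_simps)
      have "integral {\<theta> + real k * d..\<theta> + real (Suc k) * d} (\<lambda>_. \<phi> (\<theta> + real k * d) - e)
          \<le> integral {\<theta> + real k * d..\<theta> + real (Suc k) * d} \<phi>"
      proof (rule integral_le)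
        fix t assume t: "t \<in> {\<theta> + real k * d..\<theta> + real (Suc k) * d}"
        then have "dist t (\<theta> + real k * d) < \<delta>" using d by (auto simp: dist_real_def algebra_simps)
        moreover have "t \<in> {0..4*pi}" "\<theta> + real k * d \<in> {0..4*pi}"
          using t \<theta> kd d unfolding of_nat_Suc distrib_right atLeastAtMost_iff
          by (intro conjI; linarith)+
        ultimately have "dist (\<phi> t) (\<phi> (\<theta> + real k * d)) < e" by (intro \<delta>)
        then show "\<phi> (\<theta> + real k * d) - e \<le> \<phi> t" by (simp add: dist_real_def)
      qed (auto intro: int)
      then show ?thesis using d by (simp add: algebra_simps)
    qed
    have "d * (\<Sum>k<N. \<phi> (\<theta> + real k * d)) - 2 * pi * e = (\<Sum>k<N. d * (\<phi> (\<theta> + real k * d) - e))"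
      using d by (simp add: sum_subtractf sum_distrib_left right_diff_distrib flip: mult.assoc)
    also have "\<dots> \<le> (\<Sum>k<N. integral {\<theta> + real k * d..\<theta> + real (Suc k) * d} \<phi>)"
      by (intro sum_mono piece) auto
    also have "\<dots> = integral {\<theta>..\<theta> + 2 * pi} \<phi>"
      using sum_integral_consecutive[OF cont, of d \<theta> N] d by simp
    also have "\<dots> = integral {0..2*pi} \<phi>"
      using integral_periodic_shift[OF cont per \<theta>] by simp
    finally have "d * (\<Sum>k<N. \<phi> (\<theta> + real k * d)) \<le> integral {0..2*pi} \<phi> + 2 * pi * e" by simp
    then have "d * (\<Sum>k<N. \<phi> (\<theta> + real k * d)) / (2 * pi) \<le> (integral {0..2*pi} \<phi> + 2 * pi * e) / (2 * pi)"
      by (intro divide_right_mono) auto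
    moreover have "d * (\<Sum>k<N. \<phi> (\<theta> + real k * d)) / (2 * pi) = (\<Sum>k<N. \<phi> (\<theta> + real k * d)) / real N"
      by (simp add: d_def)
    ultimately show "(\<Sum>k<N. \<phi> (\<theta> + real k * (2 * pi / real N))) / real N
        \<le> integral {0..2*pi} \<phi> / (2 * pi) + e"
      by (simp add: add_divide_distrib flip: d_def)
  qed
qed

text \<open>The product of \<open>f (\<omega> z)\<close> over the \<open>N\<close>-th roots of unity \<open>\<omega>\<close> turns the maximum principle into a
  bound by Riemann sums of the circle mean, so the zeros of \<open>f\<close> need no separate treatment.\<close>

lemma ln_max_norm_submean:
  fixes f :: "complex \<Rightarrow> complex"
  assumes hol: "f holomorphic_on UNIV" and "\<eta> > 0" "r > 0"
  shows "ln (max (norm (f 0)) \<eta>)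
    \<le> integral {0..2*pi} (\<lambda>\<theta>. ln (max (norm (f (of_real r * cis \<theta>))) \<eta>)) / (2 * pi)"
proof -
  define \<phi> where "\<phi> = (\<lambda>\<theta>. ln (max (norm (f (of_real r * cis \<theta>))) \<eta>))"
  have contf: "continuous_on UNIV f" by (rule holomorphic_on_imp_continuous_on[OF hol])
  have pos: "max (norm z) \<eta> > 0" for z :: complex using \<open>\<eta> > 0\<close> by (simp add: less_max_iff_disj)
  have cont: "continuous_on UNIV \<phi>"
    unfolding \<phi>_def
    by (intro continuous_intros continuous_on_compose2[OF contf]) (use \<open>\<eta> > 0\<close> in \<open>auto simp: max_def\<close>)
  have per: "\<phi> (t + 2 * pi) = \<phi> t" for t
    unfolding \<phi>_def by (simp add: cis.ctr)
  have lower: "ln \<eta> \<le> \<phi> t" for t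
    unfolding \<phi>_def using \<open>\<eta> > 0\<close> by (intro ln_mono) (auto simp: pos)
  have "ln (max (norm (f 0)) \<eta>) \<le> integral {0..2*pi} \<phi> / (2 * pi) + e" if e: "e > 0" for e
  proof -
    obtain N where N: "N > 0" and sum_le: "\<And>\<theta>. 0 \<le> \<theta> \<Longrightarrow> \<theta> \<le> 2 * pi \<Longrightarrow>
      (\<Sum>k<N. \<phi> (\<theta> + real k * (2 * pi / real N))) / real N \<le> integral {0..2*pi} \<phi> / (2 * pi) + e"
      using periodic_riemann_sum_le[OF cont per e] by blast
    define B where "B = integral {0..2*pi} \<phi> / (2 * pi) + e"
    define g where "g = (\<lambda>z. \<Prod>k<N. f (z * cis (real k * (2 * pi / real N))))"
    have holg: "g holomorphic_on UNIV"
      unfolding g_def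
      by (intro holomorphic_intros holomorphic_on_compose_gen[OF _ hol, unfolded o_def]) auto
    have "norm (g 0) \<le> exp (real N * B)"
    proof (rule maximum_modulus_frontier[where S = "ball 0 r" and f = g and \<xi> = 0])
      show "g holomorphic_on interior (ball 0 r)" "continuous_on (closure (ball 0 r)) g"
        using holg by (auto intro: holomorphic_on_subset holomorphic_on_imp_continuous_on continuous_on_subset)
      fix z :: complex assume "z \<in> frontier (ball 0 r)"
      then have "norm z = r" using \<open>r > 0\<close> by (simp add: frontier_ball)
      then have z: "z = of_real r * cis (Arg2pi z)"
        using Arg2pi[of z] by (simp add: is_Arg_def cis_conv_exp mult.commute)
      \<comment> \<open>On the circle each factor of \<open>g\<close> is a value of \<open>f\<close>
        at a rotated angle, hence at most the truncated modulus \<open>exp \<phi>\<close>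
        there.\<close>
      have fz: "norm (f (z * cis t)) \<le> exp (\<phi> (Arg2pi z + t))" for t
        by (subst z) (simp add: \<phi>_def pos mult.assoc cis_mult)
      have "norm (g z) \<le> (\<Prod>k<N. exp (\<phi> (Arg2pi z + real k * (2 * pi / real N))))"
        unfolding g_def by (subst prod_norm[symmetric]) (intro prod_mono conjI fz norm_ge_zero)
      also have "\<dots> = exp (\<Sum>k<N. \<phi> (Arg2pi z + real k * (2 * pi / real N)))"
        by (simp add: exp_sum)
      also have "\<dots> \<le> exp (real N * B)"
        using sum_le[of "Arg2pi z"] Arg2pi[of z] N by (simp add: B_def field_simps)
      finally show "norm (g z) \<le> exp (real N * B)" .
    qed (use \<open>r > 0\<close> in auto)
    moreover have "g 0 = f 0 ^ N" by (simp add: g_def)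
    ultimately have "norm (f 0) ^ N \<le> exp B ^ N"
      by (simp add: norm_power exp_of_nat_mult)
    then have "norm (f 0) \<le> exp B"
      using N by (simp add: power_mono_iff)
    \<comment> \<open>The other entry of the maximum: \<phi> is at least \<open>ln \<eta>\<close>
      everywhere, hence so is each of its Riemann sums.\<close>
    moreover have "\<eta> \<le> exp B"
    proof -
      have "(\<Sum>k<N. ln \<eta>) \<le> (\<Sum>k<N. \<phi> (0 + real k * (2 * pi / real N)))"
        by (intro sum_mono lower)
      then have "ln \<eta> \<le> (\<Sum>k<N. \<phi> (0 + real k * (2 * pi / real N))) / real N"
        using N by (simp add: field_simps)
      also have "\<dots> \<le> B" using sum_le[of 0] by (simp add: B_def)
      finally have "ln \<eta> \<le> B" .
      then show ?thesis using \<open>\<eta> > 0\<close> by (metis exp_le_cancel_iff exp_ln)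
    qed
    ultimately have "max (norm (f 0)) \<eta> \<le> exp B" by simp
    then have "ln (max (norm (f 0)) \<eta>) \<le> ln (exp B)"
      using pos by (intro ln_mono) auto
    then show ?thesis by (simp add: B_def)
  qed
  then show ?thesis
    unfolding \<phi>_def by (rule field_le_epsilon)
qed

text \<open>The positive part of \<open>G\<close> integrates to 0 and integrability makes the
  integral of the negative part finite, so the difference of extended reals is an ordinary
  integral.\<close>

lemma circle_mean_nonpos:
  fixes u :: "complex ^ 'n \<Rightarrow> ereal"
  assumes u: "\<And>\<theta>. u (a + (complex_of_real r * cis \<theta>) *s b) = ereal (G \<theta>)"
    and nonpos: "\<And>\<theta>. G \<theta> \<le> 0"
    and int: "set_integrable lborel {0..2*pi} G"
  shows "circle_mean u a b r = ereal ((LBINT \<theta>:{0..2*pi}. G \<theta>) / (2 * pi))"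
proof -
  have 1: "(\<integral>\<^sup>+ \<theta>. e2ennreal (max 0 (ereal (G \<theta>))) * indicator {0..2*pi} \<theta> \<partial>lborel) = 0"
  proof -
    have "max 0 (ereal (G \<theta>)) = 0" for \<theta> using nonpos[of \<theta>] by (simp add: max_absorb1)
    then show ?thesis by (simp flip: zero_ennreal_def)
  qed
  have "(\<integral>\<^sup>+ \<theta>. e2ennreal (max 0 (- ereal (G \<theta>))) * indicator {0..2*pi} \<theta> \<partial>lborel)
      = (\<integral>\<^sup>+ \<theta>. ennreal (- (indicator {0..2*pi} \<theta> *\<^sub>R G \<theta>)) \<partial>lborel)"
    using nonpos by (intro nn_integral_cong) (auto simp: indicator_def max_def ennreal.rep_eq)
  also have "\<dots> = ennreal (\<integral>\<theta>. - (indicator {0..2*pi} \<theta> *\<^sub>R G \<theta>) \<partial>lborel)"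
    using int nonpos unfolding set_integrable_def
    by (intro nn_integral_eq_integral) (auto simp: indicator_def)
  also have "\<dots> = ennreal (- (LBINT \<theta>:{0..2*pi}. G \<theta>))"
    by (simp add: set_lebesgue_integral_def)
  finally have 2: "(\<integral>\<^sup>+ \<theta>. e2ennreal (max 0 (- ereal (G \<theta>))) * indicator {0..2*pi} \<theta> \<partial>lborel)
      = ennreal (- (LBINT \<theta>:{0..2*pi}. G \<theta>))" .
  have "(LBINT \<theta>:{0..2*pi}. G \<theta>) \<le> 0"
  proof -
    have "0 \<le> (\<integral>\<theta>. - (indicator {0..2*pi} \<theta> *\<^sub>R G \<theta>) \<partial>lborel)"
      using nonpos by (intro Bochner_Integration.integral_nonneg) (auto simp: indicator_def)
    then show ?thesis by (simp add: set_lebesgue_integral_def)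
  qed
  then have "enn2ereal (ennreal (- (LBINT \<theta>:{0..2*pi}. G \<theta>))) = ereal (- (LBINT \<theta>:{0..2*pi}. G \<theta>))"
    by (simp add: enn2ereal_ennreal)
  then show ?thesis
    unfolding circle_mean_def Let_def u 1 2 by (simp add: zero_ennreal.rep_eq)
qed

text \<open>Upper semicontinuity holds because the limit lies below each continuous
  \<open>v n\<close> on the open set \<open>D n\<close>. The sub-mean value inequality passes to the
  limit by dominated convergence, the values on a circle being eventually between \<open>l\<close>
  and 0.\<close>

lemma psh_decreasing_limit:
  fixes v :: "nat \<Rightarrow> complex ^ 'n \<Rightarrow> real" and D :: "nat \<Rightarrow> (complex ^ 'n) set"
  assumes opn: "\<And>n. open (D n)" and mono: "\<And>n m. n \<le> m \<Longrightarrow> D n \<subseteq> D m"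
    and cont: "\<And>n. continuous_on UNIV (v n)"
    and decr: "\<And>n x. x \<in> D n \<Longrightarrow> v (Suc n) x \<le> v n x"
    and nonpos: "\<And>n x. x \<in> D n \<Longrightarrow> v n x \<le> 0"
    and bdd: "\<And>n x. l \<le> v n x"
    and submean: "\<And>n a b r. r > 0 \<Longrightarrow>
      v n a \<le> integral {0..2*pi} (\<lambda>\<theta>. v n (a + (complex_of_real r * cis \<theta>) *s b)) / (2 * pi)"
  shows psh_lim: "psh (\<Union>n. D n) (\<lambda>x. ereal (lim (\<lambda>n. v n x)))"
    and lim_le: "\<And>n x. x \<in> D n \<Longrightarrow> lim (\<lambda>n. v n x) \<le> v n x"
    and lim_tendsto: "\<And>n x. x \<in> D n \<Longrightarrow> (\<lambda>n. v n x) \<longlonglongrightarrow> lim (\<lambda>n. v n x)"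
proof -
  have dec: "decseq (\<lambda>m. v (m + n) x)" if "x \<in> D n" for n x
    using mono[of n "_ + n"] decr that by (intro decseq_SucI) auto
  show lim: "(\<lambda>n. v n x) \<longlonglongrightarrow> lim (\<lambda>n. v n x)" if x: "x \<in> D n" for n x
  proof -
    have "convergent (\<lambda>m. v (m + n) x)"
      using decseq_convergent[OF dec[OF x], of l] bdd unfolding convergent_def by metis
    then have "convergent (\<lambda>n. v n x)"
      by (rule convergent_ignore_initial_segment[THEN iffD1])
    then show ?thesis
      by (simp add: convergent_LIMSEQ_iff)
  qed
  show le: "lim (\<lambda>n. v n x) \<le> v n x" if x: "x \<in> D n" for n x
    using decseq_ge[OF dec[OF x] LIMSEQ_ignore_initial_segment[OF lim[OF x]], of 0] by simp
  define G where "G = (\<lambda>x. lim (\<lambda>n. v n x))"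
  have usc: "\<exists>e>0. \<forall>w\<in>(\<Union>n. D n) \<inter> ball z e. ereal (G w) < c"
    if z: "z \<in> D N" and c: "ereal (G z) < c" for z N c
  proof -
    \<comment> \<open>The bound \<open>c\<close> may be infinite, so a real number is inserted for
      comparison with the real-valued \<open>v n\<close>.\<close>
    obtain c' where c': "ereal (G z) < ereal c'" "ereal c' < c"
      using ereal_dense2[OF c] by auto
    have "\<forall>\<^sub>F n in sequentially. v n z < c'"
      using order_tendstoD(2)[OF lim[OF z]] c' by (auto simp: G_def)
    then obtain n\<^sub>0 where "\<And>n. n \<ge> n\<^sub>0 \<Longrightarrow> v n z < c'"
      unfolding eventually_sequentially by blast
    then obtain n where n: "n \<ge> N" "v n z < c'"
      using max.cobounded1 max.cobounded2 by blast
    have "open {w. v n w < c'}"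
      using cont[of n] by (intro open_Collect_less) auto
    then have "open ({w. v n w < c'} \<inter> D n)" using opn by auto
    moreover have "z \<in> {w. v n w < c'} \<inter> D n" using n z mono by blast
    ultimately obtain e where e: "e > 0" "ball z e \<subseteq> {w. v n w < c'} \<inter> D n"
      by (meson openE)
    have "ereal (G w) < c" if "w \<in> ball z e" for w
    proof -
      have "G w < c'" using e that le[of w n] unfolding G_def by force
      then show ?thesis using c'(2) by (meson ereal_less_le less_ereal.simps(1) order.strict_trans)
    qed
    with e show ?thesis by blast
  qed
  have mean: "ereal (G a) \<le> circle_mean (\<lambda>x. ereal (G x)) a b r"
    if r: "r > 0" and sub: "{a + \<zeta> *s b | \<zeta>. cmod \<zeta> \<le> r} \<subseteq> (\<Union>n. D n)" for a b r
  proof -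
    \<comment> \<open>By compactness the closed disc lies in a single \<open>D N\<close>; from
      \<open>N\<close> on the upper bound 0 holds on all of it.\<close>
    have "compact ((\<lambda>\<zeta>. a + \<zeta> *s b) ` cball 0 r)"
      by (intro compact_continuous_image continuous_intros
            bounded_linear.continuous_on[OF bounded_linear_smult_left]) auto
    moreover have "(\<lambda>\<zeta>. a + \<zeta> *s b) ` cball 0 r = {a + \<zeta> *s b | \<zeta>. cmod \<zeta> \<le> r}" by auto
    ultimately have "compact {a + \<zeta> *s b | \<zeta>. cmod \<zeta> \<le> r}" by simp
    then obtain C where C: "finite C" "{a + \<zeta> *s b | \<zeta>. cmod \<zeta> \<le> r} \<subseteq> (\<Union>n\<in>C. D n)"
      by (rule compactE_image[of _ UNIV D]) (use opn sub in auto)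
    define N where "N = Max (insert 0 C)"
    have "D n \<subseteq> D N" if "n \<in> C" for n
      using C that by (intro mono) (auto simp: N_def)
    with C have disc: "a + \<zeta> *s b \<in> D N" if "cmod \<zeta> \<le> r" for \<zeta>
      using that by blast
    define \<gamma> where "\<gamma> = (\<lambda>\<theta>. a + (complex_of_real r * cis \<theta>) *s b)"
    have \<gamma>D: "\<gamma> \<theta> \<in> D n" if "n \<ge> N" for \<theta> n
      using disc[of "complex_of_real r * cis \<theta>"] r mono[OF that] by (auto simp: \<gamma>_def norm_mult)
    have aD: "a \<in> D N" using disc[of 0] r by simp
    have cont\<gamma>: "continuous_on UNIV (\<lambda>\<theta>. v n (\<gamma> \<theta>))" for n
      unfolding \<gamma>_def
      by (intro continuous_on_compose2[OF cont] continuous_intros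
            bounded_linear.continuous_on[OF bounded_linear_smult_left]) auto
    have meas: "(\<lambda>\<theta>. v n (\<gamma> \<theta>)) \<in> borel_measurable lborel" for n
      using borel_measurable_continuous_onI[OF cont\<gamma>] by simp
    have limG: "(\<lambda>n. v n (\<gamma> \<theta>)) \<longlonglongrightarrow> G (\<gamma> \<theta>)" for \<theta>
      unfolding G_def by (rule lim[OF \<gamma>D[OF order.refl]])
    have measG: "(\<lambda>\<theta>. G (\<gamma> \<theta>)) \<in> borel_measurable lborel"
      by (rule borel_measurable_LIMSEQ_real[OF _ meas]) (rule limG)
    have bound: "\<bar>v n (\<gamma> \<theta>)\<bar> \<le> \<bar>l\<bar>" if "n \<ge> N" for n \<theta>
      using bdd[of n "\<gamma> \<theta>"] nonpos[OF \<gamma>D[OF that, of \<theta>]] by linarith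
    have Gnonpos: "G (\<gamma> \<theta>) \<le> 0" for \<theta>
      unfolding G_def by (rule order.trans[OF le nonpos]) (rule \<gamma>D[OF order.refl])+
    have Gge: "l \<le> G (\<gamma> \<theta>)" for \<theta>
      using LIMSEQ_le_const[OF limG] bdd by blast
    have Gbound: "\<bar>G (\<gamma> \<theta>)\<bar> \<le> \<bar>l\<bar>" for \<theta>
      using Gnonpos[of \<theta>] Gge[of \<theta>] by linarith
    have bd_int: "integrable lborel (\<lambda>\<theta>. indicator {0..2*pi} \<theta> *\<^sub>R \<bar>l\<bar>)"
      by (intro integrable_scaleR_left integrable_real_indicator) auto
    have intG: "set_integrable lborel {0..2*pi} (\<lambda>\<theta>. G (\<gamma> \<theta>))"
      unfolding set_integrable_def
    proof (rule Bochner_Integration.integrable_bound[OF bd_int])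
      show "AE \<theta> in lborel. norm (indicator {0..2*pi} \<theta> *\<^sub>R G (\<gamma> \<theta>)) \<le> norm (indicator {0..2*pi} \<theta> *\<^sub>R \<bar>l\<bar>)"
        using Gbound by (intro AE_I2) (auto simp: indicator_def)
    qed (use measG in measurable)
    have "(\<lambda>n. LBINT \<theta>:{0..2*pi}. v (n + N) (\<gamma> \<theta>)) \<longlonglongrightarrow> (LBINT \<theta>:{0..2*pi}. G (\<gamma> \<theta>))"
      unfolding set_lebesgue_integral_def
    proof (rule integral_dominated_convergence[OF _ _ bd_int])
      show "AE \<theta> in lborel. (\<lambda>n. indicator {0..2*pi} \<theta> *\<^sub>R v (n + N) (\<gamma> \<theta>))
          \<longlonglongrightarrow> indicator {0..2*pi} \<theta> *\<^sub>R G (\<gamma> \<theta>)"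
        using limG by (intro AE_I2 tendsto_intros LIMSEQ_ignore_initial_segment)
      show "AE \<theta> in lborel. norm (indicator {0..2*pi} \<theta> *\<^sub>R v (n + N) (\<gamma> \<theta>)) \<le> indicator {0..2*pi} \<theta> *\<^sub>R \<bar>l\<bar>" for n
        using bound[of "n + N"] by (intro AE_I2) (auto simp: indicator_def)
    qed (use measG meas in measurable)
    moreover have "v (n + N) a \<le> (LBINT \<theta>:{0..2*pi}. v (n + N) (\<gamma> \<theta>)) / (2 * pi)" for n
    proof -
      have "set_integrable lborel {0..2*pi} (\<lambda>\<theta>. v (n + N) (\<gamma> \<theta>))"
        unfolding set_integrable_def
      proof (rule Bochner_Integration.integrable_bound[OF bd_int])
        show "AE \<theta> in lborel. norm (indicator {0..2*pi} \<theta> *\<^sub>R v (n + N) (\<gamma> \<theta>)) \<le> norm (indicator {0..2*pi} \<theta> *\<^sub>R \<bar>l\<bar>)"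
          using bound[of "n + N"] by (intro AE_I2) (auto simp: indicator_def)
      qed (use meas in measurable)
      then show ?thesis
        using submean[OF r, of "n + N" a b] by (simp add: set_borel_integral_eq_integral \<gamma>_def)
    qed
    moreover have "(\<lambda>n. v (n + N) a) \<longlonglongrightarrow> G a"
      unfolding G_def by (intro LIMSEQ_ignore_initial_segment lim[OF aD])
    ultimately have "G a \<le> (LBINT \<theta>:{0..2*pi}. G (\<gamma> \<theta>)) / (2 * pi)"
      by (intro LIMSEQ_le[OF _ tendsto_divide[OF _ tendsto_const]]) auto
    moreover have "circle_mean (\<lambda>x. ereal (G x)) a b r = ereal ((LBINT \<theta>:{0..2*pi}. G (\<gamma> \<theta>)) / (2 * pi))"
      by (rule circle_mean_nonpos) (use Gnonpos intG in \<open>auto simp: \<gamma>_def\<close>)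
    ultimately show ?thesis by simp
  qed
  show "psh (\<Union>n. D n) (\<lambda>x. ereal (lim (\<lambda>n. v n x)))"
    unfolding psh_def using usc mean unfolding G_def by auto
qed

section \<open>The automorphisms\<close>

text \<open>By Taylor, \<open>z - sin z\<close> differs from \<open>z ^ 3 / 6\<close> by at most
  \<open>3 * norm z ^ 5 / 24\<close>, which is at most \<open>norm z ^ 3 / 128\<close>; and 1/6 plus
  or minus 1/128 lies between 1/8 and 1/4. The upper bound makes the functions \<open>v n\<close>
  decrease, the lower one makes their limit non-constant.\<close>

lemma norm_diff_sin_bounds:
  fixes z :: complex
  assumes z: "norm z \<le> 1/4"
  shows "norm (z - sin z) \<le> norm z ^ 3 / 4" "norm z ^ 3 / 8 \<le> norm (z - sin z)"
proof -
  have sum: "(\<Sum>k\<le>4. complex_of_real (sin_coeff k) * z ^ k) = z - z ^ 3 / 6"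
  proof -
    have "{..4::nat} = {0, 1, 2, 3, 4}" by auto
    then show ?thesis by (simp add: sin_coeff_def fact_numeral)
  qed
  have "\<bar>Im z\<bar> \<le> 1" using abs_Im_le_cmod[of z] z by linarith
  then have "exp \<bar>Im z\<bar> \<le> 3" using exp_le by (meson exp_le_cancel_iff order_trans)
  then have "exp \<bar>Im z\<bar> * norm z ^ 5 / 24 \<le> 3 * norm z ^ 5 / 24"
    by (intro divide_right_mono mult_right_mono) auto
  moreover have "norm (sin z - (z - z ^ 3 / 6)) \<le> exp \<bar>Im z\<bar> * norm z ^ 5 / 24"
    using Taylor_sin[of z 4] unfolding sum by (simp add: fact_numeral)
  moreover have "norm z ^ 5 = norm z ^ 3 * norm z ^ 2" by (simp flip: power_add)
  moreover have "norm z ^ 3 * norm z ^ 2 \<le> norm z ^ 3 * (1/4) ^ 2"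
    using z by (intro mult_left_mono power_mono) auto
  ultimately have err: "norm (z ^ 3 / 6 - (z - sin z)) \<le> norm z ^ 3 / 128"
    by (simp add: norm_minus_commute algebra_simps power2_eq_square)
  have main: "norm (z ^ 3 / 6) = norm z ^ 3 / 6" by (simp add: norm_divide norm_power)
  have nn: "0 \<le> norm z ^ 3" by simp
  show "norm (z - sin z) \<le> norm z ^ 3 / 4"
    using norm_triangle_ineq2[of "z - sin z" "z ^ 3 / 6"]
      norm_minus_commute[of "z - sin z" "z ^ 3 / 6"] err main nn by linarith
  show "norm z ^ 3 / 8 \<le> norm (z - sin z)"
    using norm_triangle_ineq2[of "z ^ 3 / 6" "z - sin z"] err main nn by linarith
qed

lemma norm_one_minus_cos_le:
  fixes z :: complex
  assumes z: "norm z \<le> 1/4"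
  shows "norm (1 - cos z) \<le> 3/16"
proof -
  have "\<bar>Im z\<bar> \<le> 1" using abs_Im_le_cmod[of z] z by linarith
  then have "exp \<bar>Im z\<bar> \<le> 3" using exp_le by (meson exp_le_cancel_iff order_trans)
  moreover have "norm z ^ 2 \<le> (1/4) ^ 2" using z by (intro power_mono) auto
  ultimately have "exp \<bar>Im z\<bar> * norm z ^ 2 \<le> 3 * (1/4) ^ 2" by (intro mult_mono) auto
  moreover have "norm (cos z - 1) \<le> exp \<bar>Im z\<bar> * norm z ^ 2"
    using Taylor_cos[of z 1] by (simp add: cos_coeff_def numeral_eq_Suc)
  ultimately show ?thesis by (simp add: norm_minus_commute power2_eq_square)
qed

text \<open>With \<open>t = a w - sin z\<close> the map is \<open>(z, t) \<mapsto> (z + t, a t)\<close>, which explains the inverse.\<close>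

definition shear :: "'n \<Rightarrow> 'n \<Rightarrow> complex \<Rightarrow> complex ^ 'n \<Rightarrow> complex ^ 'n" where
  "shear p q a x = (\<chi> i. if i = p then x $ p - sin (x $ p) + a * x $ q
     else if i = q then a * (a * x $ q - sin (x $ p)) else a * x $ i)"

definition shear_inv :: "'n \<Rightarrow> 'n \<Rightarrow> complex \<Rightarrow> complex ^ 'n \<Rightarrow> complex ^ 'n" where
  "shear_inv p q a y = (\<chi> i. if i = p then y $ p - y $ q / a
     else if i = q then (y $ q / a + sin (y $ p - y $ q / a)) / a else y $ i / a)"

lemma shear_inv_shear: "p \<noteq> q \<Longrightarrow> a \<noteq> 0 \<Longrightarrow> shear_inv p q a (shear p q a x) = x"
  by (auto simp: shear_def shear_inv_def vec_eq_iff)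

lemma shear_shear_inv: "p \<noteq> q \<Longrightarrow> a \<noteq> 0 \<Longrightarrow> shear p q a (shear_inv p q a y) = y"
  by (auto simp: shear_def shear_inv_def vec_eq_iff)

definition shear_deriv :: "'n \<Rightarrow> 'n \<Rightarrow> complex \<Rightarrow> complex ^ 'n \<Rightarrow> complex ^ 'n \<Rightarrow> complex ^ 'n" where
  "shear_deriv p q a x v = (\<chi> i. if i = p then (1 - cos (x $ p)) * v $ p + a * v $ q
     else if i = q then a * (a * v $ q - cos (x $ p) * v $ p) else a * v $ i)"

lemma complex_linear_shear_deriv: "complex_linear (shear_deriv p q a x)"
  by (auto simp: complex_linear_def shear_deriv_def vec_eq_iff algebra_simps)

lemma has_derivative_vec_nth_ident: "((\<lambda>x. x $ i) has_derivative (\<lambda>h. h $ i)) F"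
  by (rule bounded_linear_imp_has_derivative[OF bounded_linear_vec_nth])

lemma has_derivative_shear: "(shear p q a has_derivative shear_deriv p q a x) (at x)"
proof (rule has_derivative_vec_componentwise)
  have sin': "((\<lambda>x. sin (x $ p)) has_derivative (\<lambda>h. cos (x $ p) * h $ p)) (at x)"
    using has_derivative_compose[OF has_derivative_vec_nth_ident
        DERIV_sin[of "x $ p", unfolded has_field_derivative_def]] by simp
  show "((\<lambda>x. shear p q a x $ i) has_derivative (\<lambda>h. shear_deriv p q a x h $ i)) (at x)" for i
    unfolding shear_def shear_deriv_def vec_lambda_beta
    by (cases "i = p"; cases "i = q"; simp only: if_True if_False simp_thms)
       (auto intro!: derivative_eq_intros sin' has_derivative_vec_nth_ident simp: algebra_simps)
qed

lemma holo_map_shear: "holo_map (shear p q a) U"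
  unfolding holo_map_def using complex_linear_shear_deriv has_derivative_shear by blast

lemma holo_map_shear_inv: "holo_map (shear_inv p q a) U"
  unfolding holo_map_def
proof (intro ballI exI conjI)
  fix y
  \<comment> \<open>The first coordinate of the inverse is linear, hence its own derivative; it
    serves in both roles below.\<close>
  define z' where "z' = (\<lambda>v :: complex ^ 'a. v $ p - v $ q / a)"
  define L where "L = (\<lambda>v. \<chi> i. if i = p then z' v
     else if i = q then (v $ q / a + cos (z' y) * z' v) / a else v $ i / a)"
  show "complex_linear L"
    by (auto simp: complex_linear_def L_def z'_def vec_eq_iff algebra_simps add_divide_distrib diff_divide_distrib)
  have z_deriv: "(z' has_derivative z') (at y)"
    unfolding z'_def divide_inverse
    by (auto intro!: derivative_eq_intros has_derivative_vec_nth_ident)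
  have sin': "((\<lambda>x. sin (z' x)) has_derivative (\<lambda>h. cos (z' y) * z' h)) (at y)"
    using has_derivative_compose[OF z_deriv
        DERIV_sin[of "z' y", unfolded has_field_derivative_def]] by simp
  show "(shear_inv p q a has_derivative L) (at y)"
  proof (rule has_derivative_vec_componentwise)
    show "((\<lambda>x. shear_inv p q a x $ i) has_derivative (\<lambda>h. L h $ i)) (at y)" for i
      unfolding shear_inv_def L_def vec_lambda_beta divide_inverse[of _ a]
      unfolding z'_def[symmetric, unfolded divide_inverse, THEN fun_cong]
      by (cases "i = p"; cases "i = q"; simp only: if_True if_False simp_thms)
         (auto intro!: derivative_eq_intros sin' z_deriv has_derivative_vec_nth_ident simp: algebra_simps)
  qed
qed

text \<open>Apart from \<open>1 - cos\<close> in component \<open>p\<close>, every entry carries a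
  factor \<open>a\<close>. The sum over all components costs a factor \<open>CARD('n)\<close>, which
  the bound on \<open>a\<close> absorbs: 3/16 + 3/100 < 1/2.\<close>

lemma norm_shear_deriv_le:
  fixes x :: "complex ^ 'n"
  assumes x: "norm x \<le> 1/4" and a: "norm a \<le> 1 / (100 * real CARD('n))"
  shows "norm (shear_deriv p q a x v) \<le> norm v / 2"
proof -
  have card: "real CARD('n) \<ge> 1" by (simp add: Suc_leI)
  have a1: "norm a \<le> 1" using a card by (smt (verit) divide_le_eq_1_pos)
  have xp: "norm (x $ p) \<le> 1/4" using x Finite_Cartesian_Product.norm_nth_le[of x p] by linarith
  have comp: "norm (v $ i) \<le> norm v" for i by (rule Finite_Cartesian_Product.norm_nth_le)
  have cos: "norm (1 - cos (x $ p)) \<le> 3/16" by (rule norm_one_minus_cos_le[OF xp])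
  have cos2: "norm (cos (x $ p)) \<le> 2"
    using norm_triangle_ineq4[of 1 "1 - cos (x $ p)"] cos by simp
  have "norm (shear_deriv p q a x v $ i) \<le> (if i = p then 3/16 * norm v else 0) + 3 * norm a * norm v" for i
  proof -
    have *: "norm (a * v $ j) \<le> norm a * norm v" for j
      unfolding norm_mult by (intro mult_left_mono comp) auto
    have nn: "0 \<le> norm a * norm v" by simp
    consider "i = p" | "i \<noteq> p" "i = q" | "i \<noteq> p" "i \<noteq> q" by blast
    then show ?thesis
    proof cases
      case 1
      have "norm ((1 - cos (x $ p)) * v $ p) \<le> 3/16 * norm v"
        unfolding norm_mult by (intro mult_mono cos comp) auto
      then have "norm ((1 - cos (x $ p)) * v $ p + a * v $ q) \<le> 3/16 * norm v + norm a * norm v"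
        using * by (intro norm_triangle_le add_mono)
      also have "\<dots> \<le> 3/16 * norm v + 3 * (norm a * norm v)" using nn by linarith
      finally show ?thesis using 1 by (simp add: shear_deriv_def mult.assoc)
    next
      case 2
      have "norm (a * v $ q) \<le> norm v"
        unfolding norm_mult using mult_mono[OF a1 comp[of q]] by simp
      moreover have "norm (cos (x $ p) * v $ p) \<le> 2 * norm v"
        unfolding norm_mult by (intro mult_mono cos2 comp) auto
      ultimately have "norm (a * v $ q - cos (x $ p) * v $ p) \<le> 3 * norm v"
        by (intro norm_triangle_le_diff) simp
      then have "norm a * norm (a * v $ q - cos (x $ p) * v $ p) \<le> norm a * (3 * norm v)"
        by (intro mult_left_mono) auto
      then show ?thesis using 2 by (simp add: shear_deriv_def norm_mult)
    next
      case 3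
      have "norm (a * v $ i) \<le> 3 * (norm a * norm v)" using *[of i] nn by linarith
      then show ?thesis using 3 by (simp add: shear_deriv_def mult.assoc)
    qed
  qed
  then have "norm (shear_deriv p q a x v)
      \<le> (\<Sum>i\<in>UNIV. (if i = p then 3/16 * norm v else 0) + 3 * norm a * norm v)"
    by (intro order_trans[OF norm_le_sum_components] sum_mono)
  also have "\<dots> = 3/16 * norm v + 3 * (norm a * real CARD('n)) * norm v"
    by (simp add: sum.distrib algebra_simps)
  also have "\<dots> \<le> 3/16 * norm v + 3 * (1/100) * norm v"
    using a card by (intro add_left_mono mult_right_mono mult_left_mono) (auto simp: field_simps)
  also have "\<dots> \<le> norm v / 2" by simp
  finally show ?thesis .
qed

text \<open>The coordinate \<open>x $ p\<close> enters through the periodic \<open>sin\<close>, and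
  besides that only as a summand of component \<open>p\<close>.\<close>

lemma shear_equivariant:
  assumes "p \<noteq> q"
  shows "shear p q a (x - axis p (of_nat j * (2 * complex_of_real pi)))
    = shear p q a x - axis p (of_nat j * (2 * complex_of_real pi))"
  using assms by (auto simp: shear_def vec_eq_iff axis_def sin.minus_of_nat)

section \<open>Compositions of the shears and their inverses\<close>

primrec orbit :: "'n \<Rightarrow> 'n \<Rightarrow> (nat \<Rightarrow> complex) \<Rightarrow> nat \<Rightarrow> complex ^ 'n \<Rightarrow> complex ^ 'n" where
  "orbit p q a 0 x = x"
| "orbit p q a (Suc n) x = shear p q (a n) (orbit p q a n x)"

primrec orbit_inv :: "'n \<Rightarrow> 'n \<Rightarrow> (nat \<Rightarrow> complex) \<Rightarrow> nat \<Rightarrow> complex ^ 'n \<Rightarrow> complex ^ 'n" where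
  "orbit_inv p q a 0 y = y"
| "orbit_inv p q a (Suc n) y = orbit_inv p q a n (shear_inv p q (a n) y)"

lemma orbit_equivariant:
  assumes "p \<noteq> q"
  shows "orbit p q a n (x - axis p (of_nat j * (2 * complex_of_real pi)))
    = orbit p q a n x - axis p (of_nat j * (2 * complex_of_real pi))"
  by (induction n) (auto simp: shear_equivariant[OF assms])

lemma holo_map_orbit: "holo_map (orbit p q a n) UNIV"
proof (induction n)
  case 0
  show ?case using holo_map_translate[of 0 UNIV] by simp
next
  case (Suc n)
  show ?case using holo_map_compose[OF Suc holo_map_shear[of p q "a n" UNIV]] by simp
qed

lemma holo_map_orbit_inv: "holo_map (orbit_inv p q a n) UNIV"
proof (induction n)
  case 0
  show ?case using holo_map_translate[of 0 UNIV] by simp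
next
  case (Suc n)
  show ?case using holo_map_compose[OF holo_map_shear_inv[of p q "a n" UNIV] Suc] by simp
qed

lemma orbit_inv_orbit:
  assumes "p \<noteq> q" "\<And>n. a n \<noteq> 0"
  shows "orbit_inv p q a n (orbit p q a n x) = x"
  using assms by (induction n) (auto simp: shear_inv_shear)

lemma orbit_orbit_inv:
  assumes "p \<noteq> q" "\<And>n. a n \<noteq> 0"
  shows "orbit p q a n (orbit_inv p q a n y) = y"
  using assms by (induction n arbitrary: y) (auto simp: shear_shear_inv)

section \<open>Short basins\<close>

text \<open>The translation by \<open>c\<close> acts before the first factor, so the factors
  themselves keep the fixed point 0 for every center \<open>c\<close>.\<close>

lemma contracting_basin_orbit:
  fixes a :: "nat \<Rightarrow> complex"
  assumes pq: "p \<noteq> q" and nz: "\<And>n. a n \<noteq> 0"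
    and small: "\<And>n. norm (a n) \<le> 1 / (100 * real CARD('n::finite))"
  shows "contracting_basin (\<lambda>n x. orbit p q a n (x - c)) (\<lambda>n y. orbit_inv p q a n y + c)
    (\<lambda>n. shear p q (a n) :: complex ^ 'n \<Rightarrow> complex ^ 'n) (1/4)"
proof
  show "holo_map (\<lambda>x. orbit p q a n (x - c)) UNIV" for n
    using holo_map_compose[OF holo_map_translate[of "- c"] holo_map_orbit[of p q a n]] by simp
  show "holo_map (\<lambda>y. orbit_inv p q a n y + c) UNIV" for n
    using holo_map_compose[OF holo_map_orbit_inv[of p q a n] holo_map_translate[of c UNIV]] by simp
  show "shear p q (a n) 0 = 0" for n by (simp add: shear_def vec_eq_iff)
  show "\<exists>L. complex_linear L \<and> (shear p q (a n) has_derivative L) (at y) \<and>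
      (\<forall>v. norm (L v) \<le> norm v / 2)" if "norm y < 1/4" for y :: "complex ^ 'n" and n
    using complex_linear_shear_deriv has_derivative_shear norm_shear_deriv_le[OF _ small] that
    by (meson less_imp_le)
qed (simp_all add: orbit_inv_orbit[OF pq nz] orbit_orbit_inv[OF pq nz])

text \<open>The first claim needs only a bounded non-constant plurisubharmonic function, the rest
  being the basin locale. The second claim later separates basins with different centers.\<close>

lemma short_Ck_orbit_basin:
  fixes s :: real and p q :: "'n::finite" and c :: "complex ^ 'n"
  defines "a \<equiv> \<lambda>n. complex_of_real (s * s ^ 3 ^ Suc n)"
  assumes pq: "p \<noteq> q" and s: "0 < s" "s \<le> 1 / (100 * real CARD('n))"
  defines "\<Omega> \<equiv> \<Union>n. {x. norm (orbit p q a n (x - c)) < 1/4}"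
  shows "short_Ck \<Omega>" and "\<And>x. x \<in> \<Omega> \<Longrightarrow> (\<lambda>n. orbit p q a n (x - c)) \<longlonglongrightarrow> 0"
proof -
  have "real CARD('n) \<ge> 1" by (simp add: Suc_leI)
  then have "1 / (100 * real CARD('n)) \<le> 1 / 100" by (intro divide_left_mono) auto
  then have s1: "s \<le> 1 / 100" using s by linarith
  \<comment> \<open>The truncation level is cubed in each step, like the leading term of
    \<open>z - sin z\<close>, and \<open>a n = s * \<eta> (Suc n)\<close> keeps the perturbation of
    size \<open>\<eta> n ^ 3\<close>.\<close>
  define \<eta> where "\<eta> = (\<lambda>n::nat. s ^ 3 ^ n)"
  have \<eta>: "0 < \<eta> n" "\<eta> n \<le> 1" "\<eta> (Suc n) = \<eta> n ^ 3" for n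
    using s s1 unfolding \<eta>_def by (auto intro: power_le_one simp: power_mult[symmetric] mult.commute)
  have a_norm: "norm (a n) = s * \<eta> (Suc n)" for n
    using s by (simp add: a_def \<eta>_def norm_mult norm_power)
  have a_le: "norm (a n) \<le> s" "norm (a n) \<le> \<eta> (Suc n)" for n
    unfolding a_norm using \<eta>(1,2)[of "Suc n"] s s1
    by (simp_all add: mult_left_le mult_left_le_one_le)
  have nz: "a n \<noteq> 0" for n using s by (simp add: a_def)
  interpret contracting_basin "\<lambda>n x. orbit p q a n (x - c)" "\<lambda>n y. orbit_inv p q a n y + c"
    "\<lambda>n. shear p q (a n)" "1/4"
    by (rule contracting_basin_orbit[OF pq nz]) (rule order_trans[OF a_le(1) s(2)])
  have \<Omega>: "basin = \<Omega>" by (simp add: basin_def layer_def \<Omega>_def)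
  show "\<And>x. x \<in> \<Omega> \<Longrightarrow> (\<lambda>n. orbit p q a n (x - c)) \<longlonglongrightarrow> 0"
    using fwd_tendsto_0 \<Omega> by simp
  define h where "h = (\<lambda>n x. orbit p q a n (x - c) $ p)"
  have h_Suc: "h (Suc n) x = (h n x - sin (h n x)) + a n * orbit p q a n (x - c) $ q" for n x
    by (simp add: h_def shear_def)
  have h_small: "norm (h n x) \<le> 1/4" if "x \<in> layer n" for n x
    using that Finite_Cartesian_Product.norm_nth_le[of "orbit p q a n (x - c)" p]
    by (simp add: layer_def h_def)
  have perturb: "norm (a n * orbit p q a n (x - c) $ q) \<le> \<eta> n ^ 3 / 4" if "x \<in> layer n" for n x
  proof -
    have "norm (orbit p q a n (x - c) $ q) \<le> 1/4"
      using that Finite_Cartesian_Product.norm_nth_le[of "orbit p q a n (x - c)" q]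
      by (simp add: layer_def)
    then have "norm (a n) * norm (orbit p q a n (x - c) $ q) \<le> \<eta> (Suc n) * (1/4)"
      using a_le(2)[of n] \<eta>(1)[of "Suc n"] by (intro mult_mono) auto
    then show ?thesis by (simp add: norm_mult \<eta>(3))
  qed
  \<comment> \<open>Truncation removes the poles at zeros of \<open>h n\<close> and gives the
    uniform lower bound \<open>ln (\<eta> n) / 3 ^ n = ln s\<close>.\<close>
  define v where "v = (\<lambda>n x. ln (max (norm (h n x)) (\<eta> n)) / 3 ^ n)"
  have max_pos: "max (norm (h n x)) (\<eta> n) > 0" for n x using \<eta>(1)[of n] by (simp add: less_max_iff_disj)
  have h_cont: "continuous_on UNIV (h n)" for n
    unfolding h_def
    by (intro continuous_on_component holo_map_continuous_on holo_fwd)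
  have v_cont: "continuous_on UNIV (v n)" for n
    unfolding v_def using max_pos[of n]
    by (intro continuous_intros h_cont) (auto simp: order.strict_implies_not_eq[symmetric])
  have v_decr: "v (Suc n) x \<le> v n x" if x: "x \<in> layer n" for n x
  proof -
    define M where "M = max (norm (h n x)) (\<eta> n)"
    have M: "norm (h n x) \<le> M" "\<eta> n \<le> M" "0 < M" using max_pos[of n x] by (auto simp: M_def)
    have M3: "norm (h n x) ^ 3 \<le> M ^ 3" "\<eta> n ^ 3 \<le> M ^ 3"
      using M \<eta>(1)[of n] by (auto intro!: power_mono)
    \<comment> \<open>Both terms are at most \<open>M ^ 3 / 4\<close>; the cube is then cancelled by
      the additional factor 3 in the denominator of \<open>v (Suc n)\<close>.\<close>
    have "norm (h (Suc n) x) \<le> norm (h n x) ^ 3 / 4 + \<eta> n ^ 3 / 4"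
      unfolding h_Suc
      by (intro norm_triangle_le add_mono norm_diff_sin_bounds perturb h_small x)
    also have "\<dots> \<le> M ^ 3" using M3 zero_less_power[OF M(3), of 3] by linarith
    finally have "max (norm (h (Suc n) x)) (\<eta> (Suc n)) \<le> M ^ 3"
      using M3 by (simp add: \<eta>(3))
    then have "ln (max (norm (h (Suc n) x)) (\<eta> (Suc n))) \<le> ln (M ^ 3)"
      using max_pos M by (intro ln_mono) auto
    then have "ln (max (norm (h (Suc n) x)) (\<eta> (Suc n))) / 3 ^ Suc n \<le> 3 * ln M / 3 ^ Suc n"
      using M by (intro divide_right_mono) (auto simp: ln_realpow)
    then show ?thesis by (simp add: v_def M_def)
  qed
  have v_nonpos: "v n x \<le> 0" if "x \<in> layer n" for n x
    using h_small[OF that] \<eta>[of n] max_pos[of n x] unfolding v_def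
    by (intro divide_nonpos_pos) (auto simp: ln_le_zero_iff)
  \<comment> \<open>A lower bound decaying like \<open>t ^ 3 ^ n\<close> is exactly what survives as
    a bound independent of \<open>n\<close>.\<close>
  have v_ge: "ln t \<le> v n x" if t: "0 < t" "t ^ 3 ^ n \<le> max (norm (h n x)) (\<eta> n)" for t n x
  proof -
    have "ln (t ^ 3 ^ n) \<le> ln (max (norm (h n x)) (\<eta> n))"
      using t by (intro ln_mono) auto
    then show ?thesis using t by (simp add: v_def ln_realpow field_simps)
  qed
  have v_bdd: "ln s \<le> v n x" for n x
    by (rule v_ge) (use s in \<open>auto simp: \<eta>_def\<close>)
  have v_submean: "v n x \<le> integral {0..2*pi} (\<lambda>\<theta>. v n (x + (complex_of_real r * cis \<theta>) *s b)) / (2 * pi)"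
    if "r > 0" for n x b r
  proof -
    have "(\<lambda>t. h n (x + t *s b)) holomorphic_on UNIV"
      using holo_map_nth_along_line[OF holo_fwd] by (simp add: h_def)
    from ln_max_norm_submean[OF this \<eta>(1)[of n] that]
    have "ln (max (norm (h n x)) (\<eta> n)) / 3 ^ n
      \<le> (integral {0..2*pi} (\<lambda>\<theta>. ln (max (norm (h n (x + (of_real r * cis \<theta>) *s b))) (\<eta> n))) / (2 * pi)) / 3 ^ n"
      by (intro divide_right_mono) auto
    then show ?thesis by (simp add: v_def divide_divide_eq_left mult.commute)
  qed
  define G where "G = (\<lambda>x. lim (\<lambda>n. v n x))"
  note limit_rules = psh_decreasing_limit[of layer v, OF open_layer layer_mono v_cont v_decr v_nonpos v_bdd v_submean]
  have G_psh: "psh basin (\<lambda>x. ereal (G x))"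
    unfolding basin_def G_def by (rule limit_rules(1))
  have G_le: "G x \<le> v n x" if "x \<in> layer n" for n x
    unfolding G_def by (rule limit_rules(2), assumption+, rule that)
  have v_lim: "(\<lambda>n. v n x) \<longlonglongrightarrow> G x" if "x \<in> layer n" for n x
    unfolding G_def by (rule limit_rules(3), assumption+, rule that)
  define w where "w = c + axis p (1/8)"
  have c_in: "c \<in> layer 0" by (simp add: layer_def)
  have "norm (axis p (1/8 :: complex)) \<le> 1/8"
    using norm_le_sum_components[of "axis p (1/8)"] by (simp add: axis_def if_distrib[of norm] cong: if_cong)
  then have "w \<in> layer 0" by (simp add: layer_def w_def)
  then have w_in: "w \<in> layer n" for n using layer_mono[of 0 n] by blast
  \<comment> \<open>The factor 4 lets the induction close: with \<open>t = (1/32) ^ 3 ^ n\<close>,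
    \<open>(4 * t) ^ 3 / 8 = 8 * t ^ 3\<close>, and the perturbation takes away at most
    \<open>t ^ 3 / 4\<close>. It starts at 4/32 = 1/8.\<close>
  have h_w: "4 * (1/32) ^ 3 ^ n \<le> norm (h n w)" for n
  proof (induction n)
    case 0
    then show ?case by (simp add: h_def w_def axis_def)
  next
    case (Suc n)
    define t :: real where "t = (1/32) ^ 3 ^ n"
    have t: "0 < t" "(1/32) ^ 3 ^ Suc n = t ^ 3"
      by (simp_all add: t_def mult.commute flip: power_mult)
    have "\<eta> n \<le> t" unfolding \<eta>_def t_def using s s1 by (intro power_mono) auto
    then have "\<eta> n ^ 3 \<le> t ^ 3" using \<eta>(1)[of n] by (intro power_mono) auto
    moreover have "(4 * t) ^ 3 \<le> norm (h n w) ^ 3"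
      using Suc t(1) by (intro power_mono) (auto simp: t_def)
    moreover have "norm (h n w) ^ 3 / 8 \<le> norm (h n w - sin (h n w))"
      by (intro norm_diff_sin_bounds h_small w_in)
    moreover have "norm (h n w - sin (h n w)) - norm (a n * orbit p q a n (w - c) $ q) \<le> norm (h (Suc n) w)"
      unfolding h_Suc by (rule norm_diff_ineq)
    moreover have "0 < t ^ 3" using t by simp
    moreover have "(4 * t) ^ 3 = 64 * t ^ 3" by (simp add: power_mult_distrib)
    ultimately have "4 * t ^ 3 \<le> norm (h (Suc n) w)"
      using perturb[OF w_in, of n] by linarith
    then show ?case unfolding t(2) .
  qed
  have "ln (1/32) \<le> v n w" for n
  proof (rule v_ge)
    have "(1/32) ^ 3 ^ n \<le> 4 * (1/32 :: real) ^ 3 ^ n" by simp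
    with h_w[of n] show "(1/32) ^ 3 ^ n \<le> max (norm (h n w)) (\<eta> n)" by linarith
  qed auto
  then have "ln (1/32) \<le> G w"
    using LIMSEQ_le_const[OF v_lim[OF w_in]] by blast
  \<comment> \<open>Already \<open>v 0 c = ln s\<close>, as \<open>h 0 c = 0\<close> and
    \<open>\<eta> 0 = s\<close>; the bound s \<le> 1/100 < 1/32 then separates \<open>G c\<close>
    from \<open>G w\<close>.\<close>
  moreover have "G c \<le> ln s"
    using G_le[OF c_in] s by (simp add: v_def h_def \<eta>_def max_def)
  moreover have "ln s < ln (1/32)" using s s1 by (subst ln_less_cancel_iff) auto
  ultimately have ne: "ereal (G c) \<noteq> ereal (G w)" by simp
  have "short_Ck basin"
  proof (rule short_Ck_basin[OF _ _ _ _ ne])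
    show "psh basin (\<lambda>x. ereal (G x))" by (rule G_psh)
    show "ereal (G z) \<le> ereal 0" if z: "z \<in> basin" for z
    proof -
      obtain n where "z \<in> layer n" using z by (auto simp: basin_def)
      then show ?thesis using G_le[of z n] v_nonpos[of z n] by simp
    qed
  qed (use c_in w_in in \<open>auto simp: basin_def\<close>)
  then show "short_Ck \<Omega>" by (simp add: \<Omega>)
qed

section \<open>Disjoint basins with translated centers\<close>

theorem theorem1p3:
  assumes "CARD('n::finite) \<ge> 3"
  shows "\<exists>\<Omega> :: nat \<Rightarrow> (complex ^ 'n) set.
           (\<forall>i\<in>{1..CARD('n) - 1}. short_Ck (\<Omega> i)) \<and>
           (\<forall>i\<in>{1..CARD('n) - 1}. \<forall>j\<in>{1..CARD('n) - 1}. i \<noteq> j \<longrightarrow> \<Omega> i \<inter> \<Omega> j = {})"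
proof -
  obtain p q :: 'n where pq: "p \<noteq> q"
  proof -
    have "\<not> card (UNIV :: 'n set) \<le> Suc 0" using assms by simp
    then show ?thesis using that card_le_Suc0_iff_eq[of "UNIV :: 'n set"] by auto
  qed
  define s where "s = 1 / (100 * real CARD('n))"
  have s: "0 < s" "s \<le> 1 / (100 * real CARD('n))" by (simp_all add: s_def)
  define a where "a = (\<lambda>n. complex_of_real (s * s ^ 3 ^ Suc n))"
  \<comment> \<open>The centers differ by periods of \<open>sin\<close> in coordinate
    \<open>p\<close>, hence are fixed by all the shears.\<close>
  define c :: "nat \<Rightarrow> complex ^ 'n" where "c = (\<lambda>j. axis p (of_nat j * (2 * complex_of_real pi)))"
  define \<Omega> where "\<Omega> = (\<lambda>j. \<Union>n. {x. norm (orbit p q a n (x - c j)) < 1/4})"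
  have short: "short_Ck (\<Omega> j)" for j
    unfolding \<Omega>_def a_def by (rule short_Ck_orbit_basin(1)[OF pq s])
  have lim: "(\<lambda>n. orbit p q a n (x - c j)) \<longlonglongrightarrow> 0" if "x \<in> \<Omega> j" for x j
    using that unfolding \<Omega>_def a_def by (rule short_Ck_orbit_basin(2)[OF pq s])
  have "i = j" if "x \<in> \<Omega> i" "x \<in> \<Omega> j" for i j x
  proof -
    \<comment> \<open>Equivariance converts convergence of the shifted orbit to 0 into convergence
      of the orbit of \<open>x\<close> itself to the center, and a sequence has only one
      limit.\<close>
    have "(\<lambda>n. orbit p q a n x) \<longlonglongrightarrow> c k" if "x \<in> \<Omega> k" for k
      using lim[OF that] unfolding c_def orbit_equivariant[OF pq] by (simp add: LIM_zero_iff)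
    with that have "c i = c j" by (meson LIMSEQ_unique)
    then show ?thesis by (auto simp: c_def axis_eq_axis)
  qed
  with short show ?thesis by (intro exI[of _ \<Omega>]) blast
qed

end
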